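(* Let $(\varphi_{s,t})$ be an evolution family in $\mathbb D$ (of some order $d\in[1,+\infty]$) such that there is a unique normalized Loewner chain associated with it. Let $(f_t)_{t\ge0}$ be a family of holomorphic functions $f_t:\mathbb D\to\mathbb C$, and let $\beta(t):=\frac{|\varphi_{0,t}'(0)|}{1-|\varphi_{0,t}(0)|^2}$, $t\ge0$. Then $(f_t)$ is the unique normalized Loewner chain associated with $(\varphi_{s,t})$ if and only if the following three conditions hold: (1) $f_0(0)=f_0'(0)-1=0$; (2) $f_t\circ\varphi_{s,t}=f_s$ for all $0\le s\le t$; (3) for each $R>0$ there exists $C>0$ (independent of $t$) such that for all $t\ge0$, $|f_t(z)|\le C/\beta(t)$ for every $z$ in the hyperbolic disk of radius $R$ centered at $\varphi_{0,t}(0)$.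
   Context: $\mathbb D$ is the open unit disk with its hyperbolic (Poincaré) distance, with respect to which hyperbolic disks are taken. For $d\in[1,+\infty]$, an evolution family of order $d$ is a family $(\varphi_{s,t})_{0\le s\le t<+\infty}$ of holomorphic self-maps of $\mathbb D$ with $\varphi_{s,s}=\mathrm{id}_{\mathbb D}$, $\varphi_{s,t}=\varphi_{u,t}\circ\varphi_{s,u}$ for $0\le s\le u\le t$, and such that for every $z\in\mathbb D$, $T>0$ there is a non-negative $k_{z,T}\in L^d([0,T])$ with $|\varphi_{s,u}(z)-\varphi_{s,t}(z)|\le\int_u^tk_{z,T}$ for all $0\le s\le u\le t\le T$. A Loewner chain (of some order $d'\in[1,+\infty]$) is a family $(f_t)_{t\ge0}$ of univalent holomorphic maps $f_t:\mathbb D\to\mathbb C$ with $f_s(\mathbb D)\subset f_t(\mathbb D)$ for $s<t$ and such that for every compact $K\subset\mathbb D$ and $T>0$ there is a non-negative $k_{K,T}\in L^{d'}([0,T])$ with $|f_s(z)-f_t(z)|\le\int_s^tk_{K,T}$ for $z\in K$, $0\le s\le t\le T$. It is normalized if $f_0(0)=0$, $f_0'(0)=1$, and associated with $(\varphi_{s,t})$ if $f_t\circ\varphi_{s,t}=f_s$ for all $0\le s\le t$. *)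

theory Defs
  imports "HOL-Analysis.Analysis"
begin

text \<open>Hyperbolic (Poincare) distance on the unit disk (the constant normalisation
  is irrelevant for the statement, since the radius R ranges over all R > 0).\<close>
definition hyp_dist :: "complex \<Rightarrow> complex \<Rightarrow> real" where
  "hyp_dist z w = artanh (cmod (z - w) / cmod (1 - cnj w * z))"

definition Lp_nonneg :: "ereal \<Rightarrow> real \<Rightarrow> (real \<Rightarrow> real) \<Rightarrow> bool" where
  "Lp_nonneg d T k \<longleftrightarrow>
     (\<forall>r\<in>{0..T}. 0 \<le> k r) \<and> set_borel_measurable lborel {0..T} k \<and>
     (if d = \<infinity> then (\<exists>B. AE r in lborel. r \<in> {0..T} \<longrightarrow> k r \<le> B)
      else set_integrable lborel {0..T} (\<lambda>r. k r powr real_of_ereal d))"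

definition evolution_family :: "ereal \<Rightarrow> (real \<Rightarrow> real \<Rightarrow> complex \<Rightarrow> complex) \<Rightarrow> bool" where
  "evolution_family d \<phi> \<longleftrightarrow> 1 \<le> d \<and>
     (\<forall>s t. 0 \<le> s \<and> s \<le> t \<longrightarrow> \<phi> s t holomorphic_on ball 0 1 \<and> \<phi> s t ` ball 0 1 \<subseteq> ball 0 1) \<and>
     (\<forall>s\<ge>0. \<forall>z\<in>ball 0 1. \<phi> s s z = z) \<and>
     (\<forall>s u t. 0 \<le> s \<and> s \<le> u \<and> u \<le> t \<longrightarrow> (\<forall>z\<in>ball 0 1. \<phi> s t z = \<phi> u t (\<phi> s u z))) \<and>
     (\<forall>z\<in>ball 0 1. \<forall>T>0. \<exists>k. Lp_nonneg d T k \<and>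
        (\<forall>s u t. 0 \<le> s \<and> s \<le> u \<and> u \<le> t \<and> t \<le> T \<longrightarrow>
           cmod (\<phi> s u z - \<phi> s t z) \<le> set_lebesgue_integral lborel {u..t} k))"

definition loewner_chain_of_order :: "ereal \<Rightarrow> (real \<Rightarrow> complex \<Rightarrow> complex) \<Rightarrow> bool" where
  "loewner_chain_of_order d f \<longleftrightarrow> 1 \<le> d \<and>
     (\<forall>t\<ge>0. f t holomorphic_on ball 0 1 \<and> inj_on (f t) (ball 0 1)) \<and>
     (\<forall>s t. 0 \<le> s \<and> s < t \<longrightarrow> f s ` ball 0 1 \<subseteq> f t ` ball 0 1) \<and>
     (\<forall>K T. compact K \<and> K \<subseteq> ball 0 1 \<and> T > 0 \<longrightarrow> (\<exists>k. Lp_nonneg d T k \<and>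
        (\<forall>z\<in>K. \<forall>s t. 0 \<le> s \<and> s \<le> t \<and> t \<le> T \<longrightarrow>
           cmod (f s z - f t z) \<le> set_lebesgue_integral lborel {s..t} k)))"

definition loewner_chain :: "(real \<Rightarrow> complex \<Rightarrow> complex) \<Rightarrow> bool" where
  "loewner_chain f \<longleftrightarrow> (\<exists>d. loewner_chain_of_order d f)"

definition normalized :: "(real \<Rightarrow> complex \<Rightarrow> complex) \<Rightarrow> bool" where
  "normalized f \<longleftrightarrow> f 0 0 = 0 \<and> deriv (f 0) 0 = 1"

definition associated :: "(real \<Rightarrow> complex \<Rightarrow> complex) \<Rightarrow> (real \<Rightarrow> real \<Rightarrow> complex \<Rightarrow> complex) \<Rightarrow> bool" where
  "associated f \<phi> \<longleftrightarrow> (\<forall>s t. 0 \<le> s \<and> s \<le> t \<longrightarrow> (\<forall>z\<in>ball 0 1. f t (\<phi> s t z) = f s z))"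

definition normalized_LC_of :: "(real \<Rightarrow> real \<Rightarrow> complex \<Rightarrow> complex) \<Rightarrow> (real \<Rightarrow> complex \<Rightarrow> complex) \<Rightarrow> bool" where
  "normalized_LC_of \<phi> f \<longleftrightarrow> loewner_chain f \<and> normalized f \<and> associated f \<phi>"

definition same_family :: "(real \<Rightarrow> complex \<Rightarrow> complex) \<Rightarrow> (real \<Rightarrow> complex \<Rightarrow> complex) \<Rightarrow> bool" where
  "same_family f g \<longleftrightarrow> (\<forall>t\<ge>0. \<forall>z\<in>ball 0 1. f t z = g t z)"

end

theory Submission
  imports Defs "HOL-Complex_Analysis.Complex_Analysis"
begin

text \<open>
  If \<open>g\<close> is a normalized chain associated with the evolution family, then \<open>g t\<close> composed with the
  disk automorphism taking 0 to \<open>\<phi> 0 t 0\<close> is univalent, fixes 0 and has derivative of modulus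
  \<open>1 / \<beta> t\<close> there. A growth estimate for univalent functions gives condition (3). Conversely, if
  the normalized chain \<open>g\<close> is unique, its ranges exhaust the plane: otherwise composing with
  \<open>w0 * w / (w0 - w)\<close>, where \<open>w0\<close> is omitted, gives a second one. Hence a family satisfying (2) is
  \<open>F (g t z)\<close> with \<open>F\<close> entire. Since \<open>g t\<close> maps a hyperbolic disk of fixed radius onto a set
  containing a disk of radius comparable to \<open>1 / \<beta> t\<close>, and \<open>1 / \<beta> t\<close> is unbounded, (3) makes \<open>F\<close>
  affine, and (1) makes it the identity.
\<close>

section \<open>Covering and growth estimates for univalent functions\<close>

text \<open>
  A square root \<open>g\<close> of \<open>1 - G / w0\<close> never vanishes and, by injectivity of \<open>G\<close>, never takes
  the value \<open>- g 0\<close>. So \<open>- g / g 0\<close> omits 0 and 1, and Schottky's theorem bounds it.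
\<close>
lemma univalent_bound_omitted_value:
  fixes r :: real
  assumes "0 < r" "r < 1"
  obtains M where "0 < M"
    "\<And>G w0 z. G holomorphic_on ball 0 1 \<Longrightarrow> inj_on G (ball 0 1) \<Longrightarrow> G 0 = 0 \<Longrightarrow>
       w0 \<notin> G ` ball 0 1 \<Longrightarrow> cmod z \<le> r \<Longrightarrow> cmod (G z) \<le> M * cmod w0"
proof -
  \<comment> \<open>\<open>Schottky\<close> needs holomorphy on the closed disk, so the argument is
    scaled by a radius strictly between \<open>r\<close> and 1.\<close>
  define \<rho> where "\<rho> = (1 + r) / 2"
  have \<rho>: "0 < \<rho>" "\<rho> < 1" "r < \<rho>" using assms by (auto simp: \<rho>_def)
  define t where "t = r / \<rho>"
  have t: "0 < t" "t < 1" using \<rho> assms by (auto simp: t_def)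
  \<comment> \<open>This is the Schottky bound at points of modulus at most \<open>t\<close>; the
    factor 1 in \<open>2 * 1\<close> is the bound on \<open>cmod (h 0)\<close>, which holds because
    \<open>g 0\<close> is a square root of 1.\<close>
  define S where "S = exp (pi * exp (pi * (2 + 2 * 1 + 12 * t / (1 - t))))"
  show thesis
  proof
    show "0 < 1 + S\<^sup>2" by (simp add: add_pos_nonneg)
    fix G :: "complex \<Rightarrow> complex" and w0 z
    assume hol: "G holomorphic_on ball 0 1" and inj: "inj_on G (ball 0 1)" and G0: "G 0 = 0"
      and om: "w0 \<notin> G ` ball 0 1" and z: "cmod z \<le> r"
    have w0: "w0 \<noteq> 0" using om G0 by force
    have nz: "1 - G z / w0 \<noteq> 0" if "z \<in> ball 0 1" for z
      using om that w0 by (auto simp: field_simps)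
    obtain g where holg: "g holomorphic_on ball 0 1" and g: "\<And>z. z \<in> ball 0 1 \<Longrightarrow> 1 - G z / w0 = (g z)\<^sup>2"
      by (rule contractible_imp_holomorphic_sqrt[of "\<lambda>z. 1 - G z / w0" "ball 0 1"])
        (use nz w0 in \<open>auto intro!: holomorphic_intros hol convex_imp_contractible\<close>)
    have g0: "(g 0)\<^sup>2 = 1" using g[of 0] G0 by simp
    define h where "h = (\<lambda>\<zeta>::complex. g (\<rho> * \<zeta>) / (- g 0))"
    have in_ball: "of_real \<rho> * \<zeta> \<in> ball 0 1" if "\<zeta> \<in> cball 0 1" for \<zeta> :: complex
    proof -
      have "\<rho> * cmod \<zeta> \<le> \<rho> * 1" using that \<rho> by (intro mult_left_mono) auto
      moreover have "\<rho> * cmod \<zeta> = cmod (of_real \<rho> * \<zeta>)" using \<rho> by (simp add: norm_mult)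
      ultimately have "cmod (of_real \<rho> * \<zeta>) < 1" using \<rho> by linarith
      thus ?thesis by simp
    qed
    have "cmod (h (z / \<rho>)) \<le> S"
      unfolding S_def
    proof (rule Schottky[where f = h])
      show "h holomorphic_on cball 0 1"
      proof -
        have "(g \<circ> (\<lambda>\<zeta>. \<rho> * \<zeta>)) holomorphic_on cball 0 1"
          by (rule holomorphic_on_compose_gen[OF _ holg]) (use in_ball in \<open>auto intro!: holomorphic_intros\<close>)
        moreover have "g 0 \<noteq> 0" using g0 by auto
        ultimately show ?thesis unfolding h_def o_def by (auto intro!: holomorphic_on_divide holomorphic_on_minus)
      qed
      show "cmod (h 0) \<le> 1" using g0 by (auto simp: h_def norm_divide)
      show "\<not> (h \<zeta> = 0 \<or> h \<zeta> = 1)" if "\<zeta> \<in> cball 0 1" for \<zeta>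
      proof
        assume "h \<zeta> = 0 \<or> h \<zeta> = 1"
        moreover have g0': "g 0 \<noteq> 0" using g0 by auto
        ultimately have "g (\<rho> * \<zeta>) = 0 \<or> g (\<rho> * \<zeta>) = - g 0"
          unfolding h_def divide_eq_0_iff divide_eq_1_iff by auto
        moreover have "g (\<rho> * \<zeta>) \<noteq> 0" using g[OF in_ball[OF that]] nz[OF in_ball[OF that]] by auto
        \<comment> \<open>Squaring gives \<open>G (\<rho> * \<zeta>) = G 0\<close>, so
          \<open>\<zeta> = 0\<close> and the equation turns into \<open>g 0 = - g 0\<close>.\<close>
        ultimately have eq: "g (\<rho> * \<zeta>) = - g 0" by blast
        hence "1 - G (\<rho> * \<zeta>) / w0 = 1" using g[OF in_ball[OF that]] g0 by simp
        hence "G (\<rho> * \<zeta>) = G 0" using w0 G0 by simp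
        hence "\<rho> * \<zeta> = 0" using inj in_ball[OF that] by (auto dest!: inj_onD)
        thus False using eq g0' \<rho> by auto
      qed
      show "cmod (z / \<rho>) \<le> t" using z \<rho> by (auto simp: t_def norm_divide divide_right_mono)
    qed (use t in auto)
    hence "cmod (g z) \<le> S"
      using \<rho> g0 by (auto simp: h_def norm_divide power2_eq_1_iff)
    hence "(cmod (g z))\<^sup>2 \<le> S\<^sup>2" by (intro power_mono) auto
    moreover have "G z = w0 * (1 - (g z)\<^sup>2)"
      using g[of z] z assms w0 by (auto simp: field_simps)
    moreover have "cmod (1 - (g z)\<^sup>2) \<le> 1 + (cmod (g z))\<^sup>2"
      using norm_triangle_ineq4[of 1 "(g z)\<^sup>2"] by (simp add: norm_power)
    ultimately have "cmod (G z) \<le> cmod w0 * (1 + S\<^sup>2)"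
      by (auto simp: norm_mult intro!: mult_left_mono)
    thus "cmod (G z) \<le> (1 + S\<^sup>2) * cmod w0" by (simp add: mult.commute)
  qed
qed

text \<open>A Koebe covering theorem with an unspecified constant in place of 1/4. An omitted value
  \<open>w\<close> bounds \<open>G\<close> by \<open>M * cmod w\<close> on the disk of radius 1/2,
  and Cauchy's inequality there bounds \<open>deriv G 0\<close> by
  \<open>2 * M * cmod w\<close>.\<close>

lemma univalent_covering:
  obtains c :: real where "0 < c"
    "\<And>G. G holomorphic_on ball 0 1 \<Longrightarrow> inj_on G (ball 0 1) \<Longrightarrow> G 0 = 0 \<Longrightarrow>
       ball 0 (c * cmod (deriv G 0)) \<subseteq> G ` ball 0 1"
proof -
  obtain M :: real where M: "0 < M"
    "\<And>G w0 z. G holomorphic_on ball 0 1 \<Longrightarrow> inj_on G (ball 0 1) \<Longrightarrow> G 0 = 0 \<Longrightarrow>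
       w0 \<notin> G ` ball 0 1 \<Longrightarrow> cmod z \<le> 1/2 \<Longrightarrow> cmod (G z) \<le> M * cmod w0"
    by (rule univalent_bound_omitted_value[of "1/2"]) auto
  show thesis
  proof
    show "0 < 1 / (2 * M)" using M by simp
    fix G :: "complex \<Rightarrow> complex"
    assume hol: "G holomorphic_on ball 0 1" and inj: "inj_on G (ball 0 1)" and G0: "G 0 = 0"
    show "ball 0 (1 / (2 * M) * cmod (deriv G 0)) \<subseteq> G ` ball 0 1"
    proof (rule subsetI, rule ccontr)
      fix w assume w: "w \<in> ball 0 (1 / (2 * M) * cmod (deriv G 0))" "w \<notin> G ` ball 0 1"
      have "cmod ((deriv ^^ 1) G 0) \<le> fact 1 * (M * cmod w) / (1/2) ^ 1"
      proof (rule Cauchy_inequality)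
        show "G holomorphic_on ball 0 (1/2)"
          by (rule holomorphic_on_subset[OF hol]) auto
        show "continuous_on (cball 0 (1/2)) G"
          by (rule continuous_on_subset[OF holomorphic_on_imp_continuous_on[OF hol]]) auto
      qed (use M(2)[OF hol inj G0 w(2)] in auto)
      thus False using w(1) M(1) by (auto simp: field_simps)
    qed
  qed
qed

text \<open>Both claims are the Schwarz lemma for \<open>H\<close>, the inverse of \<open>G\<close>
  on \<open>ball 0 \<rho>\<close> rescaled to a self-map of the unit disk: one from its derivative
  at 0, the other from its values.\<close>

lemma univalent_inverse_on_ball:
  assumes hol: "G holomorphic_on ball 0 1" and inj: "inj_on G (ball 0 1)" and G0: "G 0 = 0"
    and "0 < \<rho>" and sub: "ball 0 \<rho> \<subseteq> G ` ball 0 1"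
  shows "\<rho> \<le> cmod (deriv G 0)"
    and "cmod w < \<rho> \<Longrightarrow> \<exists>z. cmod z \<le> cmod w / \<rho> \<and> cmod z < 1 \<and> G z = w"
proof -
  obtain h where h: "h holomorphic_on G ` ball 0 1"
    "\<And>z. z \<in> ball 0 1 \<Longrightarrow> deriv G z * deriv h (G z) = 1" "\<And>z. z \<in> ball 0 1 \<Longrightarrow> h (G z) = z"
    using holomorphic_has_inverse[OF hol open_ball inj] by metis
  have h0: "h 0 = 0" using h(3)[of 0] G0 by simp
  define H where "H = (\<lambda>z::complex. h (\<rho> * z))"
  have arg: "of_real \<rho> * z \<in> ball 0 \<rho>" if "cmod z < 1" for z :: complex
    using that \<open>0 < \<rho>\<close> by (simp add: norm_mult)
  have arg': "of_real \<rho> * z \<in> G ` ball 0 1" if "cmod z < 1" for z :: complex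
    using arg[OF that] sub by blast
  have H1: "H holomorphic_on ball 0 1"
    unfolding H_def using arg'
    by (auto intro!: holomorphic_intros holomorphic_on_compose_gen[OF _ h(1), unfolded o_def])
  have H2: "cmod (H z) < 1" if "cmod z < 1" for z
    using arg'[OF that] h(3) by (auto simp: H_def)
  have H0: "H 0 = 0" by (simp add: H_def h0)
  have dh: "deriv G 0 * deriv h 0 = 1" using h(2)[of 0] G0 by simp
  have "h field_differentiable at 0"
    using h(1) sub \<open>0 < \<rho>\<close>
    by (intro holomorphic_on_imp_differentiable_at[OF holomorphic_on_subset[OF h(1) sub]]) auto
  hence "(h has_field_derivative deriv h 0) (at (of_real \<rho> * 0))"
    by (simp add: DERIV_deriv_iff_field_differentiable)
  hence "(H has_field_derivative deriv h 0 * \<rho>) (at 0)"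
    unfolding H_def by (rule DERIV_chain2) (auto intro!: derivative_eq_intros)
  hence "deriv H 0 = deriv h 0 * \<rho>" by (rule DERIV_imp_deriv)
  moreover have "cmod (deriv H 0) \<le> 1"
    by (rule Schwarz_Lemma(2)[OF H1 H0 H2, of 0]) auto
  ultimately have "cmod (deriv h 0) * \<rho> \<le> 1" using \<open>0 < \<rho>\<close> by (simp add: norm_mult)
  moreover have "cmod (deriv G 0) * cmod (deriv h 0) = 1" using dh by (metis norm_mult norm_one)
  moreover have "cmod (deriv G 0) * (cmod (deriv h 0) * \<rho>) \<le> cmod (deriv G 0) * 1"
    by (rule mult_left_mono) (use calculation in auto)
  ultimately show "\<rho> \<le> cmod (deriv G 0)"
    by (simp flip: mult.assoc)
  show "\<exists>z. cmod z \<le> cmod w / \<rho> \<and> cmod z < 1 \<and> G z = w" if w: "cmod w < \<rho>"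
  proof (rule exI[of _ "h w"], intro conjI)
    have n: "cmod (w / \<rho>) < 1" using w \<open>0 < \<rho>\<close> by (simp add: norm_divide)
    have *: "H (w / \<rho>) = h w" using \<open>0 < \<rho>\<close> by (simp add: H_def)
    show "cmod (h w) \<le> cmod w / \<rho>"
      using Schwarz_Lemma(1)[OF H1 H0 H2 n] \<open>0 < \<rho>\<close> by (simp add: * norm_divide)
    show "cmod (h w) < 1" using H2[OF n] * by simp
    have "w \<in> G ` ball 0 1" using sub w by auto
    thus "G (h w) = w" using h(3) by auto
  qed
qed

text \<open>The Schwarz lemma prevents the image from containing too large a disk, so there is an
  omitted value comparable to \<open>deriv G 0\<close>, to which the bound by an omitted value
  applies.\<close>

lemma univalent_growth:
  fixes r :: real
  assumes "0 < r" "r < 1"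
  obtains C where "0 < C"
    "\<And>G z. G holomorphic_on ball 0 1 \<Longrightarrow> inj_on G (ball 0 1) \<Longrightarrow> G 0 = 0 \<Longrightarrow>
       cmod z \<le> r \<Longrightarrow> cmod (G z) \<le> C * cmod (deriv G 0)"
proof -
  obtain M :: real where M: "0 < M"
    "\<And>G w0 z. G holomorphic_on ball 0 1 \<Longrightarrow> inj_on G (ball 0 1) \<Longrightarrow> G 0 = 0 \<Longrightarrow>
       w0 \<notin> G ` ball 0 1 \<Longrightarrow> cmod z \<le> r \<Longrightarrow> cmod (G z) \<le> M * cmod w0"
    by (rule univalent_bound_omitted_value[OF assms]) blast
  show thesis
  proof
    show "0 < M * 2" using M by simp
    fix G :: "complex \<Rightarrow> complex" and z
    assume hol: "G holomorphic_on ball 0 1" and inj: "inj_on G (ball 0 1)" and G0: "G 0 = 0"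
      and z: "cmod z \<le> r"
    have nz: "deriv G 0 \<noteq> 0"
      using holomorphic_injective_imp_regular[OF hol open_ball inj] by auto
    \<comment> \<open>Any factor greater than 1 would do in place of 2: a covered disk about 0 has
      radius at most \<open>cmod (deriv G 0)\<close>.\<close>
    hence "\<not> ball 0 (2 * cmod (deriv G 0)) \<subseteq> G ` ball 0 1"
      using univalent_inverse_on_ball(1)[OF hol inj G0, of "2 * cmod (deriv G 0)"] by auto
    then obtain w where w: "cmod w < 2 * cmod (deriv G 0)" "w \<notin> G ` ball 0 1"
      unfolding subset_iff mem_ball_0 by blast
    have "cmod (G z) \<le> M * cmod w" by (rule M(2)[OF hol inj G0 w(2) z])
    also have "\<dots> \<le> M * (2 * cmod (deriv G 0))" using w M(1) by (intro mult_left_mono) auto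
    finally show "cmod (G z) \<le> M * 2 * cmod (deriv G 0)" by simp
  qed
qed

section \<open>Hyperbolic disks in terms of disk automorphisms\<close>

lemma artanh_mono_real:
  fixes x y :: real
  assumes "-1 < x" "x \<le> y" "y < 1"
  shows "artanh x \<le> artanh y"
proof -
  have "(1 + x) / (1 - x) \<le> (1 + y) / (1 - y)" using assms by (intro frac_le) auto
  moreover have "0 < (1 + x) / (1 - x)" using assms by auto
  ultimately show ?thesis unfolding artanh_def by (auto intro: ln_mono)
qed

lemma hyp_dist_Moebius: "hyp_dist z a = artanh (cmod (Moebius_function 0 a z))"
  by (simp add: hyp_dist_def Moebius_function_simple norm_divide)

text \<open>Moving the centre \<open>a\<close> to 0 turns a hyperbolic disk into a Euclidean one, to
  which the estimates on \<open>cmod z \<le> r\<close> apply.\<close>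

lemma Moebius_less_tanh:
  assumes "cmod a < 1" "cmod z < 1" "hyp_dist z a < R"
  shows "cmod (Moebius_function 0 a z) < tanh R"
proof (rule ccontr)
  assume "\<not> ?thesis"
  hence "artanh (tanh R) \<le> artanh (cmod (Moebius_function 0 a z))"
    using Moebius_function_norm_lt_1[OF assms(1,2), of 0]
    by (intro artanh_mono_real) (auto simp: tanh_real_gt_neg1)
  thus False using assms(3) by (simp add: hyp_dist_Moebius artanh_tanh_real)
qed

section \<open>Integrable majorants and transformations of Loewner chains\<close>

text \<open>The interval is bounded, so constants are integrable on it. The function is dominated by
  its essential bound if \<open>d = \<infinity>\<close>, and otherwise through
  \<open>x \<le> 1 + x powr p\<close> with \<open>p \<ge> 1\<close>.\<close>

lemma Lp_nonneg_integrable: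
  assumes "1 \<le> d" and k: "Lp_nonneg d T k"
  shows "set_integrable lborel {0..T} k"
proof -
  have meas: "(\<lambda>r. indicator {0..T} r *\<^sub>R k r) \<in> borel_measurable lborel"
    using k by (simp add: Lp_nonneg_def set_borel_measurable_def)
  have const: "integrable lborel (\<lambda>r. indicator {0..T} r *\<^sub>R B)" for B :: real
    by (intro integrable_scaleR_left integrable_real_indicator) (auto simp: emeasure_lborel_Icc_eq)
  show ?thesis
  proof (cases "d = \<infinity>")
    case True
    then obtain B where B: "AE r in lborel. r \<in> {0..T} \<longrightarrow> k r \<le> B"
      using k by (auto simp: Lp_nonneg_def)
    show ?thesis unfolding set_integrable_def
    proof (rule Bochner_Integration.integrable_bound[OF const meas])
      show "AE r in lborel. norm (indicator {0..T} r *\<^sub>R k r) \<le> norm (indicator {0..T} r *\<^sub>R B)"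
        using B by eventually_elim (use k in \<open>auto simp: Lp_nonneg_def indicator_def\<close>)
    qed
  next
    case False
    define p where "p = real_of_ereal d"
    have p: "1 \<le> p" using False \<open>1 \<le> d\<close> by (cases d) (auto simp: p_def one_ereal_def)
    have int: "integrable lborel (\<lambda>r. indicator {0..T} r *\<^sub>R (k r powr p))"
      using k False by (simp add: Lp_nonneg_def set_integrable_def p_def)
    have le: "x \<le> 1 + x powr p" if "0 \<le> x" for x :: real
    proof (cases "x \<le> 1")
      case False
      hence "x powr 1 \<le> x powr p" using p by (intro powr_mono) auto
      thus ?thesis using False by simp
    qed (simp add: add_increasing2)
    show ?thesis unfolding set_integrable_def
    proof (rule Bochner_Integration.integrable_bound[OF Bochner_Integration.integrable_add[OF const[of 1] int] meas])
      show "AE r in lborel. norm (indicator {0..T} r *\<^sub>R k r)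
          \<le> norm (indicator {0..T} r *\<^sub>R 1 + indicator {0..T} r *\<^sub>R (k r powr p))"
        using k le by (auto simp: Lp_nonneg_def indicator_def)
    qed
  qed
qed

lemma Lp_nonneg_mult:
  assumes k: "Lp_nonneg d T k" and "0 \<le> c"
  shows "Lp_nonneg d T (\<lambda>r. c * k r)"
  unfolding Lp_nonneg_def
proof (intro conjI)
  have "(\<lambda>r. c * (indicator {0..T} r *\<^sub>R k r)) \<in> borel_measurable lborel"
    using k by (intro borel_measurable_times) (auto simp: Lp_nonneg_def set_borel_measurable_def)
  thus "set_borel_measurable lborel {0..T} (\<lambda>r. c * k r)"
    by (simp add: set_borel_measurable_def mult.left_commute)
  show "\<forall>r\<in>{0..T}. 0 \<le> c * k r" using assms by (auto simp: Lp_nonneg_def)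
  show "if d = \<infinity> then \<exists>B. AE r in lborel. r \<in> {0..T} \<longrightarrow> c * k r \<le> B
    else set_integrable lborel {0..T} (\<lambda>r. (c * k r) powr real_of_ereal d)"
  proof (cases "d = \<infinity>")
    case True
    then obtain B where B: "AE r in lborel. r \<in> {0..T} \<longrightarrow> k r \<le> B"
      using k by (auto simp: Lp_nonneg_def)
    have "AE r in lborel. r \<in> {0..T} \<longrightarrow> c * k r \<le> c * B"
      using B by eventually_elim (use \<open>0 \<le> c\<close> in \<open>auto intro: mult_left_mono\<close>)
    thus ?thesis using True by auto
  next
    case False
    hence "set_integrable lborel {0..T} (\<lambda>r. c powr real_of_ereal d * k r powr real_of_ereal d)"
      using k by (intro set_integrable_mult_right) (auto simp: Lp_nonneg_def)
    also have "?this \<longleftrightarrow> set_integrable lborel {0..T} (\<lambda>r. (c * k r) powr real_of_ereal d)"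
      by (rule set_integrable_cong) (use assms in \<open>auto simp: Lp_nonneg_def powr_mult\<close>)
    finally show ?thesis using False by simp
  qed
qed

lemma loewner_chain_univalent:
  assumes "loewner_chain_of_order d g" "0 \<le> t"
  shows "g t holomorphic_on ball 0 1" "inj_on (g t) (ball 0 1)"
  using assms by (auto simp: loewner_chain_of_order_def)

lemma loewner_chain_range_mono:
  assumes "loewner_chain_of_order d g" "0 \<le> s" "s \<le> t"
  shows "g s ` ball 0 1 \<subseteq> g t ` ball 0 1"
  using assms unfolding loewner_chain_of_order_def by (cases "s = t") auto

text \<open>Joint continuity follows from two separate moduli: in time, increments are controlled
  uniformly on \<open>K\<close> by the continuous primitive \<open>I\<close> of the majorant; in
  space, each \<open>g t\<close> is holomorphic. It serves to make the image of
  \<open>{0..T} \<times> K\<close> compact.\<close>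

lemma loewner_chain_continuous:
  assumes g: "loewner_chain_of_order d g" and K: "compact K" "K \<subseteq> ball 0 1" and "0 < T"
  shows "continuous_on ({0..T} \<times> K) (\<lambda>p. g (fst p) (snd p))"
proof -
  obtain k where k: "Lp_nonneg d T k" and
    le: "\<And>z s t. z \<in> K \<Longrightarrow> 0 \<le> s \<Longrightarrow> s \<le> t \<Longrightarrow> t \<le> T \<Longrightarrow>
           cmod (g s z - g t z) \<le> set_lebesgue_integral lborel {s..t} k"
    using g K \<open>0 < T\<close> unfolding loewner_chain_of_order_def by meson
  have "1 \<le> d" using g by (simp add: loewner_chain_of_order_def)
  hence int: "set_integrable lborel {0..T} k" using k by (rule Lp_nonneg_integrable)
  define I where "I = (\<lambda>t. integral {0..t} k)"
  have contI: "continuous_on {0..T} I" unfolding I_def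
    by (rule indefinite_integral_continuous_1[OF set_borel_integral_eq_integral(1)[OF int]])
  have ord: "cmod (g s z - g t z) \<le> \<bar>I s - I t\<bar>"
    if "z \<in> K" "0 \<le> s" "s \<le> t" "t \<le> T" for s t z
  proof -
    have sub: "set_integrable lborel {s..t} k"
      by (rule set_integrable_subset[OF int]) (use that in auto)
    have "integral {0..s} k + integral {s..t} k = integral {0..t} k"
      using that set_borel_integral_eq_integral(1)[OF set_integrable_subset[OF int, of "{0..t}"]]
      by (intro Henstock_Kurzweil_Integration.integral_combine) auto
    thus ?thesis
      using le[OF that] set_borel_integral_eq_integral(2)[OF sub] by (simp add: I_def)
  qed
  have diff: "cmod (g s z - g t z) \<le> \<bar>I s - I t\<bar>" if "z \<in> K" "s \<in> {0..T}" "t \<in> {0..T}" for s t z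
    using ord[of z s t] ord[of z t s] that by (cases "s \<le> t") (auto simp: norm_minus_commute abs_minus_commute)
  show ?thesis
    unfolding continuous_on_def
  proof
    fix p assume p: "p \<in> {0..T} \<times> K"
    obtain t z where pt: "p = (t, z)" and t: "t \<in> {0..T}" and z: "z \<in> K" using p by auto
    \<comment> \<open>A continuous majorant of the distance to \<open>g t z\<close> that vanishes at
      \<open>p\<close>: first the time is changed to \<open>t\<close>, then the point to
      \<open>z\<close>.\<close>
    define m where "m = (\<lambda>q. \<bar>I (fst q) - I t\<bar> + cmod (g t (snd q) - g t z))"
    have "continuous_on K (g t)"
      using loewner_chain_univalent(1)[OF g, of t] t K(2)
      by (auto intro: continuous_on_subset holomorphic_on_imp_continuous_on)
    hence "continuous_on ({0..T} \<times> K) (\<lambda>q. g t (snd q))"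
      by (rule continuous_on_compose2) (auto intro: continuous_on_snd continuous_on_id)
    moreover have "continuous_on ({0..T} \<times> K) (\<lambda>q. I (fst q))"
      by (rule continuous_on_compose2[OF contI]) (auto intro: continuous_on_fst continuous_on_id)
    ultimately have "continuous_on ({0..T} \<times> K) m"
      unfolding m_def by (intro continuous_intros)
    hence "(m \<longlongrightarrow> m p) (at p within {0..T} \<times> K)" using p by (auto simp: continuous_on_def)
    hence m0: "(m \<longlongrightarrow> 0) (at p within {0..T} \<times> K)" by (simp add: m_def pt)
    have "((\<lambda>q. g (fst q) (snd q) - g t z) \<longlongrightarrow> 0) (at p within {0..T} \<times> K)"
    proof (rule Lim_null_comparison[OF _ m0])
      show "\<forall>\<^sub>F q in at p within {0..T} \<times> K. cmod (g (fst q) (snd q) - g t z) \<le> m q"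
        unfolding eventually_at_filter
      proof (intro always_eventually allI impI)
        fix q assume q: "q \<in> {0..T} \<times> K"
        have "cmod (g (fst q) (snd q) - g t z)
            \<le> cmod (g (fst q) (snd q) - g t (snd q)) + cmod (g t (snd q) - g t z)"
          using norm_triangle_ineq[of "g (fst q) (snd q) - g t (snd q)" "g t (snd q) - g t z"] by simp
        thus "cmod (g (fst q) (snd q) - g t z) \<le> m q"
          using diff[of "snd q" "fst q" t] q t by (auto simp: m_def)
      qed
    qed
    thus "((\<lambda>q. g (fst q) (snd q)) \<longlongrightarrow> g (fst p) (snd p)) (at p within {0..T} \<times> K)"
      by (simp add: pt LIM_zero_iff)
  qed
qed

text \<open>The map \<open>w0 * w / (w0 - w)\<close> is a Moebius transformation with its only pole
  at the omitted value \<open>w0\<close>, so it preserves univalence and inclusion of ranges. Away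
  from the pole it is Lipschitz, so a majorant only changes by a constant factor.\<close>

lemma loewner_chain_omitting:
  assumes g: "loewner_chain_of_order d g" and w0: "\<And>t. 0 \<le> t \<Longrightarrow> w0 \<notin> g t ` ball 0 1" and nz: "w0 \<noteq> 0"
  shows "loewner_chain_of_order d (\<lambda>t z. w0 * g t z / (w0 - g t z))"
  unfolding loewner_chain_of_order_def
proof (intro conjI allI impI)
  have ne: "w0 - g t z \<noteq> 0" if "0 \<le> t" "z \<in> ball 0 1" for t z using w0[OF that(1)] that(2) by auto
  show "1 \<le> d" using g by (simp add: loewner_chain_of_order_def)
  show "(\<lambda>z. w0 * g t z / (w0 - g t z)) holomorphic_on ball 0 1" if "0 \<le> t" for t
    using g that ne[OF that] unfolding loewner_chain_of_order_def by (auto intro!: holomorphic_intros)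
  show "inj_on (\<lambda>z. w0 * g t z / (w0 - g t z)) (ball 0 1)" if "0 \<le> t" for t
  proof (rule inj_onI)
    fix x y assume xy: "x \<in> ball 0 1" "y \<in> ball 0 1"
      "w0 * g t x / (w0 - g t x) = w0 * g t y / (w0 - g t y)"
    hence "w0 * (w0 * g t x) = w0 * (w0 * g t y)"
      using ne[OF that xy(1)] ne[OF that xy(2)] by (simp add: frac_eq_eq algebra_simps)
    hence "g t x = g t y" using nz by simp
    thus "x = y" using loewner_chain_univalent(2)[OF g that] xy by (auto dest: inj_onD)
  qed
  show "(\<lambda>z. w0 * g s z / (w0 - g s z)) ` ball 0 1 \<subseteq> (\<lambda>z. w0 * g t z / (w0 - g t z)) ` ball 0 1"
    if "0 \<le> s \<and> s < t" for s t
  proof -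
    have "g s ` ball 0 1 \<subseteq> g t ` ball 0 1" using g that unfolding loewner_chain_of_order_def by auto
    hence "(\<lambda>w. w0 * w / (w0 - w)) ` (g s ` ball 0 1) \<subseteq> (\<lambda>w. w0 * w / (w0 - w)) ` (g t ` ball 0 1)"
      by (rule image_mono)
    thus ?thesis by (simp add: image_image)
  qed
  fix K :: "complex set" and T :: real
  assume "compact K \<and> K \<subseteq> ball 0 1 \<and> T > 0"
  hence K: "compact K" "K \<subseteq> ball 0 1" "0 < T" by auto
  \<comment> \<open>All values taken on \<open>K\<close> up to time \<open>T\<close> form a compact
    set without \<open>w0\<close>; its distance from \<open>w0\<close> gives one
    \<open>\<delta>\<close> for all times and points.\<close>
  define J where "J = (\<lambda>p. g (fst p) (snd p)) ` ({0..T} \<times> K)"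
  have "compact J" unfolding J_def
    by (rule compact_continuous_image[OF loewner_chain_continuous[OF g K]])
      (use K in \<open>auto intro: compact_Times\<close>)
  moreover have "w0 \<notin> J" using w0 K(2) by (force simp: J_def)
  ultimately obtain \<delta> where \<delta>: "0 < \<delta>" "\<And>x. x \<in> J \<Longrightarrow> \<delta> \<le> dist w0 x"
    using separate_point_closed compact_imp_closed by metis
  have \<delta>': "\<delta> \<le> cmod (w0 - g t z)" if "t \<in> {0..T}" "z \<in> K" for t z
    using \<delta>(2)[of "g t z"] that by (force simp: J_def dist_norm)
  obtain k where k: "Lp_nonneg d T k" and
    le: "\<And>z s t. z \<in> K \<Longrightarrow> 0 \<le> s \<Longrightarrow> s \<le> t \<Longrightarrow> t \<le> T \<Longrightarrow>
           cmod (g s z - g t z) \<le> set_lebesgue_integral lborel {s..t} k"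
    using g K unfolding loewner_chain_of_order_def by meson
  \<comment> \<open>The Lipschitz constant: images of \<open>u\<close> and \<open>v\<close> differ
    by \<open>w0\<^sup>2 * (u - v) / ((w0 - u) * (w0 - v))\<close>, and both denominators have
    modulus at least \<open>\<delta>\<close>.\<close>
  define c where "c = (cmod w0 / \<delta>)\<^sup>2"
  show "\<exists>k. Lp_nonneg d T k \<and> (\<forall>z\<in>K. \<forall>s t. 0 \<le> s \<and> s \<le> t \<and> t \<le> T \<longrightarrow>
      cmod (w0 * g s z / (w0 - g s z) - w0 * g t z / (w0 - g t z)) \<le> set_lebesgue_integral lborel {s..t} k)"
  proof (intro exI conjI ballI allI impI)
    show "Lp_nonneg d T (\<lambda>r. c * k r)" by (rule Lp_nonneg_mult[OF k]) (simp add: c_def)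
    fix z s t assume z: "z \<in> K" and st: "0 \<le> s \<and> s \<le> t \<and> t \<le> T"
    define A B where "A = w0 - g s z" and "B = w0 - g t z"
    have AB: "A \<noteq> 0" "B \<noteq> 0" "\<delta> \<le> cmod A" "\<delta> \<le> cmod B"
      using \<delta>'[OF _ z, of s] \<delta>'[OF _ z, of t] st \<delta>(1) by (auto simp: A_def B_def)
    have "w0 * g s z / A - w0 * g t z / B = w0\<^sup>2 * (g s z - g t z) / (A * B)"
      using AB(1,2) by (simp add: divide_simps) (simp add: A_def B_def algebra_simps power2_eq_square)
    hence "cmod (w0 * g s z / A - w0 * g t z / B) = (cmod w0)\<^sup>2 * cmod (g s z - g t z) / (cmod A * cmod B)"
      by (simp add: norm_divide norm_mult norm_power)
    also have "\<dots> \<le> (cmod w0)\<^sup>2 * cmod (g s z - g t z) / (\<delta> * \<delta>)"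
      using AB \<delta>(1) by (intro divide_left_mono mult_mono mult_pos_pos) auto
    also have "\<dots> = c * cmod (g s z - g t z)"
      by (simp add: c_def power2_eq_square)
    also have "\<dots> \<le> c * set_lebesgue_integral lborel {s..t} k"
      using le[OF z, of s t] st by (intro mult_left_mono) (auto simp: c_def)
    finally show "cmod (w0 * g s z / (w0 - g s z) - w0 * g t z / (w0 - g t z))
        \<le> set_lebesgue_integral lborel {s..t} (\<lambda>r. c * k r)"
      by (simp add: A_def B_def)
  qed
qed

section \<open>Entire functions of linear growth\<close>

text \<open>Cauchy's inequality kills every Taylor coefficient of order at least 2. A bound along
  some unbounded set of radii is enough, which is all that the chain supplies.\<close>

lemma entire_linear_growth:
  assumes hol: "F holomorphic_on UNIV" and "0 < K"
    and grow: "\<And>M. \<exists>\<rho>\<ge>M. \<forall>w. cmod w \<le> \<rho> \<longrightarrow> cmod (F w) \<le> K * \<rho>"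
  shows "F w = F 0 + deriv F 0 * w"
proof -
  have van: "(deriv ^^ n) F 0 = 0" if n: "2 \<le> n" for n
  proof (rule ccontr)
    assume nz: "(deriv ^^ n) F 0 \<noteq> 0"
    define D where "D = cmod ((deriv ^^ n) F 0)"
    have D: "0 < D" using nz by (simp add: D_def)
    \<comment> \<open>Radius at least 1 lets \<open>\<rho> ^ n\<close> be replaced by
      \<open>\<rho> ^ 2\<close>; the other term exceeds the bound \<open>fact n * K / D\<close> that
      Cauchy's inequality then forces on \<open>\<rho>\<close>.\<close>
    obtain \<rho> where \<rho>: "\<rho> \<ge> max 1 (fact n * K / D + 1)" "\<And>w. cmod w \<le> \<rho> \<Longrightarrow> cmod (F w) \<le> K * \<rho>"
      using grow by meson
    have "D \<le> fact n * (K * \<rho>) / \<rho> ^ n" unfolding D_def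
      by (rule Cauchy_inequality)
        (use \<rho> hol in \<open>auto intro: holomorphic_on_subset continuous_on_subset holomorphic_on_imp_continuous_on\<close>)
    also have "\<dots> \<le> fact n * (K * \<rho>) / \<rho> ^ 2"
      using \<rho> \<open>0 < K\<close> n by (intro divide_left_mono power_increasing) auto
    also have "\<dots> = fact n * K / \<rho>" using \<rho>(1) by (simp add: power2_eq_square)
    finally have "\<rho> \<le> fact n * K / D" using D \<rho>(1) by (simp add: field_simps)
    thus False using \<rho>(1) by simp
  qed
  have "(\<lambda>n. (deriv ^^ n) F 0 / fact n * (w - 0) ^ n) sums F w"
    by (rule holomorphic_power_series[of _ _ "cmod w + 1"]) (auto intro: holomorphic_on_subset[OF hol])
  moreover have "(\<lambda>n. (deriv ^^ n) F 0 / fact n * (w - 0) ^ n) sums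
      (\<Sum>n<2. (deriv ^^ n) F 0 / fact n * (w - 0) ^ n)"
    by (rule sums_finite) (auto simp: van)
  ultimately have "F w = (\<Sum>n<2. (deriv ^^ n) F 0 / fact n * (w - 0) ^ n)" by (rule sums_unique2)
  thus ?thesis by (simp add: numeral_2_eq_2)
qed

section \<open>Recentring a chain at the image of 0\<close>

text \<open>\<open>Moebius_function 0 (- a)\<close> is the disk automorphism inverse to
  \<open>Moebius_function 0 a\<close>; it sends 0 to \<open>a\<close> with derivative
  \<open>1 - (cmod a)\<^sup>2\<close> there.\<close>

lemma Moebius_normal_form:
  fixes g :: "complex \<Rightarrow> complex"
  assumes hol: "g holomorphic_on ball 0 1" and inj: "inj_on g (ball 0 1)" and a: "cmod a < 1"
    and G_def: "G = (\<lambda>z. g (Moebius_function 0 (- a) z))"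
  shows "G holomorphic_on ball 0 1" "inj_on G (ball 0 1)" "G 0 = g a"
    "deriv G 0 = deriv g a * (1 - (cmod a)\<^sup>2)" "G ` ball 0 1 = g ` ball 0 1"
    "z \<in> ball 0 1 \<Longrightarrow> G (Moebius_function 0 a z) = g z"
proof -
  let ?m = "Moebius_function 0 (- a)"
  have m: "?m z \<in> ball 0 1" if "z \<in> ball 0 1" for z
    using Moebius_function_norm_lt_1[of "- a" z 0] a that by simp
  have m': "Moebius_function 0 a z \<in> ball 0 1" if "z \<in> ball 0 1" for z
    using Moebius_function_norm_lt_1[of a z 0] a that by simp
  have inv: "Moebius_function 0 a (?m z) = z" if "z \<in> ball 0 1" for z
    using Moebius_function_compose[of a "- a" z] a that by simp
  have inv': "?m (Moebius_function 0 a z) = z" if "z \<in> ball 0 1" for z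
    using Moebius_function_compose[of "- a" a z] a that by simp
  have mhol: "?m holomorphic_on ball 0 1" using a by (intro Moebius_function_holomorphic) simp
  show "G holomorphic_on ball 0 1"
    using holomorphic_on_compose_gen[OF mhol hol] m unfolding G_def o_def by blast
  show "inj_on G (ball 0 1)"
    unfolding G_def by (rule inj_onI) (metis inj_onD[OF inj] m inv)
  show G0: "G 0 = g a" by (simp add: G_def Moebius_function_of_zero)
  show Gm: "G (Moebius_function 0 a z) = g z" if "z \<in> ball 0 1" for z
    using inv'[OF that] by (simp add: G_def)
  show "G ` ball 0 1 = g ` ball 0 1"
  proof
    show "G ` ball 0 1 \<subseteq> g ` ball 0 1" using m by (auto simp: G_def)
    show "g ` ball 0 1 \<subseteq> G ` ball 0 1" using Gm m' by (metis image_eqI image_subsetI)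
  qed
  have m0: "?m 0 = a" by (simp add: Moebius_function_of_zero)
  have "((\<lambda>z. (z - (- a)) / (1 - cnj (- a) * z)) has_field_derivative (1 - (cmod a)\<^sup>2)) (at 0)"
    by (auto intro!: derivative_eq_intros simp: complex_norm_square simp del: of_real_power)
  hence "(?m has_field_derivative (1 - (cmod a)\<^sup>2)) (at 0)"
    by (simp add: Moebius_function_simple[abs_def])
  moreover have "(g has_field_derivative deriv g a) (at (?m 0))"
    unfolding m0 using hol a by (intro holomorphic_derivI[of _ "ball 0 1"]) auto
  ultimately have "(G has_field_derivative deriv g a * (1 - (cmod a)\<^sup>2)) (at 0)"
    unfolding G_def by (rule DERIV_chain2[rotated])
  thus "deriv G 0 = deriv g a * (1 - (cmod a)\<^sup>2)" by (rule DERIV_imp_deriv)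
qed

text \<open>Differentiating \<open>g t (\<phi> 0 t z) = g 0 z\<close> at 0 gives
  \<open>deriv (g t) a * deriv (\<phi> 0 t) 0 = 1\<close>. So \<open>\<beta>\<close> is positive,
  and the derivative of the automorphism supplies the remaining factor of
  \<open>1 / \<beta>\<close>.\<close>

lemma normalized_LC_normal_form:
  assumes EF: "evolution_family d \<phi>" and g: "normalized_LC_of \<phi> g" and t: "0 \<le> t"
    and a_def: "a = \<phi> 0 t 0" and G_def: "G = (\<lambda>z. g t (Moebius_function 0 (- a) z))"
  defines "\<beta> \<equiv> cmod (deriv (\<phi> 0 t) 0) / (1 - (cmod a)\<^sup>2)"
  shows "cmod a < 1" "0 < \<beta>" "G holomorphic_on ball 0 1" "inj_on G (ball 0 1)" "G 0 = 0"
    "cmod (deriv G 0) = 1 / \<beta>" "G ` ball 0 1 = g t ` ball 0 1"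
    "z \<in> ball 0 1 \<Longrightarrow> G (Moebius_function 0 a z) = g t z"
proof -
  obtain d' where ch: "loewner_chain_of_order d' g" and n: "normalized g" and as: "associated g \<phi>"
    using g by (auto simp: normalized_LC_of_def loewner_chain_def)
  have hol: "\<phi> 0 t holomorphic_on ball 0 1" and sub: "\<phi> 0 t ` ball 0 1 \<subseteq> ball 0 1"
    using EF t by (simp_all add: evolution_family_def)
  show a: "cmod a < 1" using sub[unfolded image_subset_iff, rule_format, of 0] by (simp add: a_def)
  have eq: "g t (\<phi> 0 t z) = g 0 z" if "z \<in> ball 0 1" for z
    using as t that by (auto simp: associated_def)
  have ga: "g t a = 0" using eq[of 0] n by (simp add: a_def normalized_def)
  note gt = loewner_chain_univalent[OF ch t]
  have "(\<phi> 0 t has_field_derivative deriv (\<phi> 0 t) 0) (at 0)"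
    using hol by (intro holomorphic_derivI[of _ "ball 0 1"]) auto
  moreover have "(g t has_field_derivative deriv (g t) a) (at (\<phi> 0 t 0))"
    unfolding a_def[symmetric] using gt(1) a by (intro holomorphic_derivI[of _ "ball 0 1"]) auto
  ultimately have "((\<lambda>z. g t (\<phi> 0 t z)) has_field_derivative deriv (g t) a * deriv (\<phi> 0 t) 0) (at 0)"
    by (rule DERIV_chain2[rotated])
  hence "(g 0 has_field_derivative deriv (g t) a * deriv (\<phi> 0 t) 0) (at 0)"
    by (rule has_field_derivative_transform_within_open[of _ _ _ "ball 0 1"]) (use eq in auto)
  hence "deriv (g t) a * deriv (\<phi> 0 t) 0 = 1"
    using n DERIV_imp_deriv by (fastforce simp: normalized_def)
  hence prod: "cmod (deriv (g t) a) * cmod (deriv (\<phi> 0 t) 0) = 1" by (metis norm_mult norm_one)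
  have pos: "0 < 1 - (cmod a)\<^sup>2" using a by (simp add: power_less_one_iff)
  have phi_pos: "0 < cmod (deriv (\<phi> 0 t) 0)" using prod by (metis mult_zero_right norm_ge_zero order_le_less zero_neq_one)
  show "0 < \<beta>" using pos phi_pos by (simp add: \<beta>_def)
  note M = Moebius_normal_form[OF gt a G_def]
  show "G holomorphic_on ball 0 1" "inj_on G (ball 0 1)" "G 0 = 0" "G ` ball 0 1 = g t ` ball 0 1"
    using M ga by auto
  show "z \<in> ball 0 1 \<Longrightarrow> G (Moebius_function 0 a z) = g t z" by (rule M(6))
  have "cmod (deriv G 0) = cmod (deriv (g t) a) * (1 - (cmod a)\<^sup>2)"
    unfolding M(4) norm_mult using pos by (metis norm_of_real abs_of_pos)
  moreover have "cmod (deriv (g t) a) = 1 / cmod (deriv (\<phi> 0 t) 0)"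
    using prod phi_pos by (simp add: eq_divide_eq)
  ultimately show "cmod (deriv G 0) = 1 / \<beta>" by (simp add: \<beta>_def)
qed

section \<open>Exhaustion of the plane and factorization through an entire function\<close>

text \<open>The transformation \<open>w0 * w / (w0 - w)\<close> fixes 0 with derivative 1, so it
  respects the normalization; it also commutes with the association, being applied after
  \<open>g t\<close>.\<close>

lemma normalized_LC_range:
  assumes g: "normalized_LC_of \<phi> g" and uniq: "\<And>h. normalized_LC_of \<phi> h \<Longrightarrow> same_family h g"
  shows "(\<Union>t\<in>{0..}. g t ` ball 0 1) = UNIV"
proof (rule ccontr)
  assume "\<not> ?thesis"
  then obtain w0 where "w0 \<notin> (\<Union>t\<in>{0..}. g t ` ball 0 1)" by blast
  hence w0: "\<And>t. 0 \<le> t \<Longrightarrow> w0 \<notin> g t ` ball 0 1" by (metis UN_I atLeast_iff)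
  obtain d where ch: "loewner_chain_of_order d g" and n: "normalized g" and as: "associated g \<phi>"
    using g by (auto simp: normalized_LC_of_def loewner_chain_def)
  have g0: "g 0 0 = 0" "deriv (g 0) 0 = 1" using n by (auto simp: normalized_def)
  have nz: "w0 \<noteq> 0" using w0[of 0] g0(1) by force
  note g0' = loewner_chain_univalent[OF ch order.refl]
  define h where "h = (\<lambda>t z. w0 * g t z / (w0 - g t z))"
  have "(g 0 has_field_derivative 1) (at 0)"
    using holomorphic_derivI[OF g0'(1) open_ball, of 0] g0(2) by simp
  hence "(h 0 has_field_derivative 1) (at 0)"
    unfolding h_def using nz by (auto intro!: derivative_eq_intros simp: g0(1))
  hence "normalized h"
    using DERIV_imp_deriv by (auto simp: normalized_def h_def g0(1))
  moreover have "associated h \<phi>" using as by (simp add: associated_def h_def)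
  moreover have "loewner_chain h"
    using loewner_chain_omitting[OF ch w0 nz] by (auto simp: loewner_chain_def h_def)
  ultimately have "same_family h g" by (intro uniq) (simp add: normalized_LC_of_def)
  \<comment> \<open>The only fixed point of the transformation is 0, so any nonzero point of the
    disk would contradict injectivity of \<open>g 0\<close>.\<close>
  hence "h 0 (1/2) = g 0 (1/2)" by (simp add: same_family_def)
  hence "g 0 (1/2) = 0"
    using w0[of 0] by (auto simp: h_def divide_simps image_iff algebra_simps split: if_splits)
  hence "g 0 (1/2) = g 0 0" using g0(1) by simp
  from inj_onD[OF g0'(2) this] show False by simp
qed

text \<open>The ranges are open and increasing, so a finite subcover of \<open>K\<close> collapses
  to its latest member.\<close>

lemma normalized_LC_absorbs:
  assumes g: "loewner_chain_of_order d g" and rng: "(\<Union>t\<in>{0..}. g t ` ball 0 1) = UNIV" and "compact K"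
  obtains t where "0 \<le> t" "K \<subseteq> g t ` ball 0 1"
proof -
  have op: "open (g t ` ball 0 1)" if "t \<in> {0..}" for t
    using loewner_chain_univalent[OF g] that by (intro open_mapping_thm3) auto
  obtain C' where C': "C' \<subseteq> {0..}" "finite C'" "K \<subseteq> (\<Union>t\<in>C'. g t ` ball 0 1)"
    by (rule compactE_image[OF \<open>compact K\<close> op, of "{0..}"]) (use rng in auto)
  \<comment> \<open>Inserting 0 keeps \<open>Max\<close> meaningful for an empty subcover.\<close>
  define t where "t = Max (insert 0 C')"
  have "0 \<le> t" using C' by (simp add: t_def)
  moreover have "g s ` ball 0 1 \<subseteq> g t ` ball 0 1" if "s \<in> C'" for s
    using that C' by (intro loewner_chain_range_mono[OF g]) (auto simp: t_def)
  ultimately show thesis using C'(3) by (intro that[of t]) blast+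
qed

text \<open>\<open>F\<close> is \<open>f t\<close> composed with the inverse of \<open>g t\<close>,
  at any time \<open>t\<close> whose range contains the point. The time does not matter: if
  \<open>g s x = g t z\<close> with \<open>s \<le> t\<close>, injectivity of \<open>g t\<close>
  forces \<open>\<phi> s t x = z\<close>, and \<open>f\<close> obeys the same relation.\<close>

lemma chain_factorization:
  assumes EF: "evolution_family d \<phi>" and g: "loewner_chain_of_order d' g" "associated g \<phi>"
    and rng: "(\<Union>t\<in>{0..}. g t ` ball 0 1) = UNIV"
    and hol: "\<And>t. 0 \<le> t \<Longrightarrow> f t holomorphic_on ball 0 1" and f: "associated f \<phi>"
  obtains F where "F holomorphic_on UNIV" "\<And>t z. 0 \<le> t \<Longrightarrow> z \<in> ball 0 1 \<Longrightarrow> f t z = F (g t z)"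
proof -
  have ord: "f s x = f t z"
    if "0 \<le> s" "s \<le> t" "x \<in> ball 0 1" "z \<in> ball 0 1" "g s x = g t z" for s t x z
  proof -
    have "\<phi> s t ` ball 0 1 \<subseteq> ball 0 1" using EF that(1,2) by (simp add: evolution_family_def)
    hence "\<phi> s t x \<in> ball 0 1" using that(3) by blast
    moreover have "g t (\<phi> s t x) = g t z" using g(2) that by (simp add: associated_def)
    ultimately have "\<phi> s t x = z"
      using loewner_chain_univalent(2)[OF g(1), of t] that by (auto dest: inj_onD)
    thus ?thesis using f that by (auto simp: associated_def)
  qed
  have "\<exists>t z. 0 \<le> t \<and> z \<in> ball 0 1 \<and> g t z = w" for w
  proof -
    have "w \<in> (\<Union>t\<in>{0..}. g t ` ball 0 1)" using rng by simp
    then obtain t where t: "t \<in> {0..}" "w \<in> g t ` ball 0 1" by (rule UN_E)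
    from t(2) obtain z where "w = g t z" "z \<in> ball 0 1" by (rule imageE)
    thus ?thesis using t(1) by auto
  qed
  then obtain \<tau> \<zeta> where \<tau>: "\<And>w. 0 \<le> \<tau> w" "\<And>w. \<zeta> w \<in> ball 0 1" "\<And>w. g (\<tau> w) (\<zeta> w) = w"
    by metis
  define F where "F = (\<lambda>w. f (\<tau> w) (\<zeta> w))"
  have F: "f t z = F (g t z)" if "0 \<le> t" "z \<in> ball 0 1" for t z
    using ord[of t "\<tau> (g t z)" z "\<zeta> (g t z)"] ord[of "\<tau> (g t z)" t "\<zeta> (g t z)" z] \<tau> that
    unfolding F_def by (metis linear)
  have "F field_differentiable at w" for w
  proof -
    \<comment> \<open>Near \<open>w\<close> a single time suffices, since the range of
      \<open>g t\<close> is open and \<open>F\<close> equals \<open>f t \<circ> h\<close> on all of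
      it.\<close>
    define t where "t = \<tau> w"
    have t: "0 \<le> t" by (simp add: t_def \<tau>)
    note u = loewner_chain_univalent[OF g(1) t]
    have op: "open (g t ` ball 0 1)" by (rule open_mapping_thm3[OF u(1) open_ball u(2)])
    have w: "w \<in> g t ` ball 0 1" using \<tau> unfolding t_def by (metis image_eqI)
    obtain h where h: "h holomorphic_on g t ` ball 0 1" "\<And>z. z \<in> ball 0 1 \<Longrightarrow> h (g t z) = z"
      using holomorphic_has_inverse[OF u(1) open_ball u(2)] by metis
    have "(f t \<circ> h) holomorphic_on g t ` ball 0 1"
      by (rule holomorphic_on_compose_gen[OF h(1) hol[OF t]]) (use h(2) in auto)
    moreover have "(f t \<circ> h) x = F x" if "x \<in> g t ` ball 0 1" for x
      using that h(2) F[OF t] by auto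
    ultimately have "F holomorphic_on g t ` ball 0 1" by (rule holomorphic_transform)
    thus ?thesis using op w by (rule holomorphic_on_imp_differentiable_at)
  qed
  hence "F holomorphic_on UNIV" by (simp add: holomorphic_on_def)
  thus thesis using F by (intro that[of F]) auto
qed

text \<open>\<open>same_family\<close> says nothing about negative times or points off the disk, so
  the two families need not be equal and the chain property has to be transferred.\<close>

lemma loewner_chain_of_order_cong:
  assumes g: "loewner_chain_of_order d g" and hol: "\<And>t. 0 \<le> t \<Longrightarrow> f t holomorphic_on ball 0 1"
    and "same_family f g"
  shows "loewner_chain_of_order d f"
  unfolding loewner_chain_of_order_def
proof (intro conjI allI impI)
  have eq: "f t z = g t z" if "0 \<le> t" "z \<in> ball 0 1" for t z
    using \<open>same_family f g\<close> that by (simp add: same_family_def)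
  have im: "f t ` ball 0 1 = g t ` ball 0 1" if "0 \<le> t" for t
    by (rule image_cong) (use eq[OF that] in auto)
  show "1 \<le> d" using g by (simp add: loewner_chain_of_order_def)
  show "f t holomorphic_on ball 0 1" if "0 \<le> t" for t by (rule hol[OF that])
  show "inj_on (f t) (ball 0 1)" if "0 \<le> t" for t
    using inj_on_cong[of "ball 0 1" "f t" "g t", OF eq[OF that]] loewner_chain_univalent(2)[OF g that] by simp
  show "f s ` ball 0 1 \<subseteq> f t ` ball 0 1" if "0 \<le> s \<and> s < t" for s t
    using im[of s] im[of t] loewner_chain_range_mono[OF g, of s t] that by simp
  fix K :: "complex set" and T :: real
  assume K: "compact K \<and> K \<subseteq> ball 0 1 \<and> 0 < T"
  then obtain k where k: "Lp_nonneg d T k" and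
    le: "\<And>z s t. z \<in> K \<Longrightarrow> 0 \<le> s \<Longrightarrow> s \<le> t \<Longrightarrow> t \<le> T \<Longrightarrow>
           cmod (g s z - g t z) \<le> set_lebesgue_integral lborel {s..t} k"
    using g unfolding loewner_chain_of_order_def by meson
  show "\<exists>k. Lp_nonneg d T k \<and> (\<forall>z\<in>K. \<forall>s t. 0 \<le> s \<and> s \<le> t \<and> t \<le> T \<longrightarrow>
       cmod (f s z - f t z) \<le> set_lebesgue_integral lborel {s..t} k)"
  proof (intro exI conjI ballI allI impI)
    fix z s t assume "z \<in> K" "0 \<le> s \<and> s \<le> t \<and> t \<le> T"
    moreover have "z \<in> ball 0 1" using \<open>z \<in> K\<close> K by blast
    ultimately show "cmod (f s z - f t z) \<le> set_lebesgue_integral lborel {s..t} k"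
      using le[of z s t] eq[of s z] eq[of t z] by simp
  qed (rule k)
qed

section \<open>The characterization of the unique normalized chain\<close>

theorem theorem3p8:
  fixes d :: ereal
    and \<phi> :: "real \<Rightarrow> real \<Rightarrow> complex \<Rightarrow> complex"
    and f :: "real \<Rightarrow> complex \<Rightarrow> complex"
  assumes EF: "evolution_family d \<phi>"
    and uniq: "\<exists>g. normalized_LC_of \<phi> g \<and> (\<forall>h. normalized_LC_of \<phi> h \<longrightarrow> same_family h g)"
    and hol: "\<forall>t\<ge>0. f t holomorphic_on ball 0 1"
  defines "\<beta> \<equiv> \<lambda>t. cmod (deriv (\<phi> 0 t) 0) / (1 - (cmod (\<phi> 0 t 0))\<^sup>2)"
  shows "(normalized_LC_of \<phi> f \<and> (\<forall>h. normalized_LC_of \<phi> h \<longrightarrow> same_family h f)) \<longleftrightarrow>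
    (f 0 0 = 0 \<and> deriv (f 0) 0 - 1 = 0) \<and>
    (\<forall>s t. 0 \<le> s \<and> s \<le> t \<longrightarrow> (\<forall>z\<in>ball 0 1. f t (\<phi> s t z) = f s z)) \<and>
    (\<forall>R>0. \<exists>C>0. \<forall>t\<ge>0. \<forall>z\<in>ball 0 1. hyp_dist z (\<phi> 0 t 0) < R \<longrightarrow> cmod (f t z) \<le> C / \<beta> t)"
  (is "?unique \<longleftrightarrow> ?norm \<and> ?assoc \<and> ?growth")
proof
  assume ?unique
  hence LC: "normalized_LC_of \<phi> f" by blast
  hence "?norm \<and> ?assoc" by (simp add: normalized_LC_of_def normalized_def associated_def)
  moreover have ?growth
  proof (intro allI impI)
    fix R :: real assume "0 < R"
    \<comment> \<open>After recentring, the hyperbolic disk lies in the Euclidean disk of radius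
      \<open>tanh R\<close>; the growth constant depends on this radius alone, hence not on
      \<open>t\<close>.\<close>
    hence "0 < tanh R" "tanh R < 1" by (auto simp: tanh_real_lt_1)
    then obtain C where C: "0 < C"
      "\<And>G z. G holomorphic_on ball 0 1 \<Longrightarrow> inj_on G (ball 0 1) \<Longrightarrow> G 0 = 0 \<Longrightarrow>
         cmod z \<le> tanh R \<Longrightarrow> cmod (G z) \<le> C * cmod (deriv G 0)"
      using univalent_growth[of "tanh R"] by blast
    have "cmod (f t z) \<le> C / \<beta> t"
      if t: "0 \<le> t" and z: "z \<in> ball 0 1" and close: "hyp_dist z (\<phi> 0 t 0) < R" for t z
    proof -
      note N = normalized_LC_normal_form[OF EF LC t refl refl]
      have "cmod (Moebius_function 0 (\<phi> 0 t 0) z) \<le> tanh R"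
        using Moebius_less_tanh[OF N(1) _ close] z by simp
      from C(2)[OF N(3-5) this] show ?thesis
        unfolding N(6) N(8)[OF z] by (simp add: \<beta>_def)
    qed
    thus "\<exists>C>0. \<forall>t\<ge>0. \<forall>z\<in>ball 0 1. hyp_dist z (\<phi> 0 t 0) < R \<longrightarrow> cmod (f t z) \<le> C / \<beta> t"
      using C(1) by blast
  qed
  ultimately show "?norm \<and> ?assoc \<and> ?growth" by blast
next
  assume R: "?norm \<and> ?assoc \<and> ?growth"
  hence fn: "normalized f" and fas: "associated f \<phi>"
    by (auto simp: normalized_def associated_def)
  obtain g where g: "normalized_LC_of \<phi> g" and gu: "\<And>h. normalized_LC_of \<phi> h \<Longrightarrow> same_family h g"
    using uniq by blast
  obtain d' where ch: "loewner_chain_of_order d' g" and gn: "normalized g" and gas: "associated g \<phi>"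
    using g by (auto simp: normalized_LC_of_def loewner_chain_def)
  note rng = normalized_LC_range[OF g gu]
  obtain F where F: "F holomorphic_on UNIV"
    "\<And>t z. 0 \<le> t \<Longrightarrow> z \<in> ball 0 1 \<Longrightarrow> f t z = F (g t z)"
    using chain_factorization[OF EF ch gas rng _ fas] hol by metis
  obtain c :: real where c: "0 < c"
    "\<And>G. G holomorphic_on ball 0 1 \<Longrightarrow> inj_on G (ball 0 1) \<Longrightarrow> G 0 = 0 \<Longrightarrow>
       ball 0 (c * cmod (deriv G 0)) \<subseteq> G ` ball 0 1"
    using univalent_covering by blast
  \<comment> \<open>One hyperbolic radius is enough. The added 1 turns the bound by
    \<open>artanh (1/2)\<close> into the strict inequality of the growth condition.\<close>
  define R0 :: real where "R0 = artanh (1/2) + 1"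
  have "0 < R0" using artanh_mono_real[of 0 "1/2"] by (simp add: R0_def)
  then obtain C where C: "0 < C"
    "\<And>t z. 0 \<le> t \<Longrightarrow> z \<in> ball 0 1 \<Longrightarrow> hyp_dist z (\<phi> 0 t 0) < R0 \<Longrightarrow> cmod (f t z) \<le> C / \<beta> t"
    using R by meson
  \<comment> \<open>The radii are \<open>\<rho> = c * L / 4\<close> with
    \<open>L = 1 / \<beta> t\<close>; there the growth condition bounds \<open>F\<close> by
    \<open>C * L\<close>, which is \<open>(4 * C / c) * \<rho>\<close>.\<close>
  have grow: "\<exists>\<rho>\<ge>M. \<forall>w. cmod w \<le> \<rho> \<longrightarrow> cmod (F w) \<le> (4 * C / c) * \<rho>" for M
  proof -
    \<comment> \<open>Chosen so that \<open>M' \<le> L\<close> yields both \<open>L \<ge> 1\<close>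
      and \<open>c * L / 4 \<ge> M\<close>.\<close>
    define M' where "M' = max 1 (4 * M / c)"
    obtain t where t: "0 \<le> t" and cover: "cball 0 M' \<subseteq> g t ` ball 0 1"
      using normalized_LC_absorbs[OF ch rng] compact_cball by metis
    define a where "a = \<phi> 0 t 0"
    define G where "G = (\<lambda>z. g t (Moebius_function 0 (- a) z))"
    note N = normalized_LC_normal_form[OF EF g t a_def G_def]
    define L where "L = cmod (deriv G 0)"
    have "ball 0 M' \<subseteq> G ` ball 0 1" using cover N(7) by force
    \<comment> \<open>Here \<open>1 / \<beta>\<close> is seen to be unbounded: a range containing a
      large disk forces a large derivative, by the Schwarz lemma for the inverse.\<close>
    hence "M' \<le> L" unfolding L_def
      by (rule univalent_inverse_on_ball(1)[OF N(3-5), rotated]) (simp add: M'_def)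
    hence L: "1 \<le> L" "4 * M / c \<le> L" by (auto simp: M'_def)
    have Lb: "1 / \<beta> t = L" using N(6) by (simp add: \<beta>_def L_def a_def)
    have "cmod (F w) \<le> (4 * C / c) * (c * L / 4)" if w: "cmod w \<le> c * L / 4" for w
    proof -
      have cov: "0 < c * L" "ball 0 (c * L) \<subseteq> G ` ball 0 1"
        using c(1) L(1) c(2)[OF N(3-5)] by (simp, simp add: L_def)
      have w': "cmod w < c * L" using w cov(1) by linarith
      obtain z where z: "cmod z \<le> cmod w / (c * L)" "cmod z < 1" "G z = w"
        using univalent_inverse_on_ball(2)[OF N(3-5) cov w'] by blast
      \<comment> \<open>The covering theorem places \<open>w\<close> in a disk on which the inverse
        contracts by \<open>1 / (c * L)\<close>, so its preimage stays within the fixed hyperbolic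
        radius.\<close>
      have "cmod w / (c * L) \<le> (c * L / 4) / (c * L)"
        using w cov(1) by (intro divide_right_mono) auto
      also have "\<dots> = 1 / 4" using c(1) L(1) by simp
      finally have z4: "cmod z \<le> 1 / 4" using z(1) by linarith
      define x where "x = Moebius_function 0 (- a) z"
      have x: "x \<in> ball 0 1" using Moebius_function_norm_lt_1[of "- a" z 0] N(1) z(2) by (simp add: x_def)
      have "Moebius_function 0 a x = z"
        using Moebius_function_compose[of a "- a" z] N(1) z(2) by (simp add: x_def)
      hence "hyp_dist x (\<phi> 0 t 0) = artanh (cmod z)" by (simp add: hyp_dist_Moebius flip: a_def)
      also have "\<dots> \<le> artanh (1/2)" using z4 norm_ge_zero[of z] by (intro artanh_mono_real) linarith+
      finally have "hyp_dist x (\<phi> 0 t 0) < R0" by (simp add: R0_def)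
      from C(2)[OF t x this] have "cmod (F (g t x)) \<le> C * (1 / \<beta> t)" using F(2)[OF t x] by simp
      moreover have "g t x = w" using z(3) by (simp add: G_def x_def)
      ultimately show ?thesis unfolding Lb using c(1) by simp
    qed
    moreover have "M \<le> c * L / 4" using L(2) c(1) by (simp add: field_simps)
    ultimately show ?thesis by blast
  qed
  have lin: "F w = F 0 + deriv F 0 * w" for w
    by (rule entire_linear_growth[OF F(1) _ grow]) (use C(1) c(1) in simp)
  have g00: "g 0 0 = 0" "deriv (g 0) 0 = 1" using gn by (auto simp: normalized_def)
  have F0: "F 0 = 0" using F(2)[of 0 0] g00 fn by (simp add: normalized_def)
  \<comment> \<open>The chain rule for \<open>f 0 = F \<circ> g 0\<close> at 0, with both
    derivatives normalized to 1, fixes the slope of the affine function \<open>F\<close>.\<close>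
  have "(g 0 has_field_derivative 1) (at 0)"
    using holomorphic_derivI[OF loewner_chain_univalent(1)[OF ch order.refl] open_ball, of 0] g00(2) by simp
  moreover have "(F has_field_derivative deriv F 0) (at (g 0 0))"
    using holomorphic_derivI[OF F(1) open_UNIV] by (simp add: g00)
  ultimately have "((\<lambda>z. F (g 0 z)) has_field_derivative deriv F 0 * 1) (at 0)"
    by (rule DERIV_chain2[rotated])
  hence "(f 0 has_field_derivative deriv F 0 * 1) (at 0)"
    by (rule has_field_derivative_transform_within_open[of _ _ _ "ball 0 1"]) (use F(2)[of 0] in auto)
  hence "deriv (f 0) 0 = deriv F 0 * 1" by (rule DERIV_imp_deriv)
  hence "deriv F 0 = 1" using fn by (simp add: normalized_def)
  hence fg: "f t z = g t z" if "0 \<le> t" "z \<in> ball 0 1" for t z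
    using F(2)[OF that] lin[of "g t z"] F0 by simp
  have "loewner_chain_of_order d' f"
    by (rule loewner_chain_of_order_cong[OF ch]) (use hol fg in \<open>auto simp: same_family_def\<close>)
  hence "normalized_LC_of \<phi> f"
    using fn fas by (auto simp: normalized_LC_of_def loewner_chain_def)
  moreover have "same_family h f" if "normalized_LC_of \<phi> h" for h
    using gu[OF that] fg by (simp add: same_family_def)
  ultimately show ?unique by blast
qed

end
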